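(* Let $M=(\mathbb{F}_2^n,m)$ be a Boolean multiset with nonempty support $S_M$. Then $M$ is fully balanced, i.e. $B(M)\cup C(M)=\mathbb{F}_2^n$, if and only if $S_M$ is an affine subspace of $\mathbb{F}_2^n$ and $m$ is constant on $S_M$.
   Context: For $\mathbf{x},\mathbf{y}\in\mathbb{F}_2^n$ the pairing is $\mathbf{x}\cdot\mathbf{y}=\sum_{i=1}^n x_iy_i\in\mathbb{F}_2$. A Boolean multiset is a pair $M=(\mathbb{F}_2^n,m)$ with $m:\mathbb{F}_2^n\to\mathbb{Z}_{\geq 0}$; its support is $S_M=\{\mathbf{x}\mid m(\mathbf{x})>0\}$. A vector $\mathbf{y}\in\mathbb{F}_2^n$ balances $M$ if $\sum_{\mathbf{x}\in S_M}m(\mathbf{x})(-1)^{\mathbf{x}\cdot\mathbf{y}}=0$, and fixes $M$ if $\left|\sum_{\mathbf{x}\in S_M}m(\mathbf{x})(-1)^{\mathbf{x}\cdot\mathbf{y}}\right|=\sum_{\mathbf{x}\in S_M}m(\mathbf{x})$. $B(M)$ is the set of vectors balancing $M$ and $C(M)$ the set of vectors fixing $M$. Affine subspaces are nonempty by convention. *)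

theory Defs
  imports "HOL-Analysis.Analysis" "HOL-Library.Z2"
begin

instance bit :: finite
proof
  have "(UNIV :: bit set) = {0, 1}"
    using bit_not_zero_iff by blast
  then show "finite (UNIV :: bit set)"
    by (metis finite.emptyI finite.insertI)
qed

text \<open>
  A Boolean multiset over the vectors of dimension \<open>CARD('n)\<close> with entries in the
  two-element field \<^typ>\<open>bit\<close> is given by its multiplicity function
  \<open>m :: bit ^ 'n \<Rightarrow> nat\<close>. The pairing is \<^const>\<open>scalar_product\<close>, computed in \<^typ>\<open>bit\<close>.
\<close>

definition support :: "(bit ^ 'n \<Rightarrow> nat) \<Rightarrow> (bit ^ 'n) set"
  where "support m = {x. m x > 0}"

text \<open>The exponent of the sign is the representative in \<open>{0, 1}\<close> of the pairing.\<close>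

definition signed_sum :: "(bit ^ 'n \<Rightarrow> nat) \<Rightarrow> bit ^ 'n \<Rightarrow> int"
  where "signed_sum m y =
    (\<Sum>x\<in>support m. int (m x) * (- 1) ^ (of_bit (scalar_product x y) :: nat))"

definition balances :: "bit ^ 'n \<Rightarrow> (bit ^ 'n \<Rightarrow> nat) \<Rightarrow> bool"
  where "balances y m \<longleftrightarrow> signed_sum m y = 0"

definition fixes_multiset :: "bit ^ 'n \<Rightarrow> (bit ^ 'n \<Rightarrow> nat) \<Rightarrow> bool"
  where "fixes_multiset y m \<longleftrightarrow> \<bar>signed_sum m y\<bar> = (\<Sum>x\<in>support m. int (m x))"

definition balancing_set :: "(bit ^ 'n \<Rightarrow> nat) \<Rightarrow> (bit ^ 'n) set"
  where "balancing_set m = {y. balances y m}"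

definition fixing_set :: "(bit ^ 'n \<Rightarrow> nat) \<Rightarrow> (bit ^ 'n) set"
  where "fixing_set m = {y. fixes_multiset y m}"

definition fully_balanced :: "(bit ^ 'n \<Rightarrow> nat) \<Rightarrow> bool"
  where "fully_balanced m \<longleftrightarrow> balancing_set m \<union> fixing_set m = UNIV"

text \<open>
  The library's \<^const>\<open>affine\<close> is restricted to real vector spaces (and admits the empty set).
  Here an affine subspace is a translate of a linear subspace, hence nonempty.
\<close>

definition affine_subspace :: "('a::field ^ 'n) set \<Rightarrow> bool"
  where "affine_subspace A \<longleftrightarrow> (\<exists>v V. vec.subspace V \<and> A = (+) v ` V)"

end

theory Submission
  imports Defs
begin

text \<open>
  Write \<open>\<chi>(x, y) = (-1)\<^bsup>x \<cdot> y\<^esup>\<close>, so that \<open>signed_sum m\<close> is the Fourier transform of \<open>m\<close>. If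
  \<open>m\<close> is fully balanced and \<open>v\<close> lies in the support, then for every \<open>y\<close> in the support of the
  transform \<open>\<chi>(\<cdot>, y)\<close> equals \<open>\<chi>(v, y)\<close> on the support of \<open>m\<close>. Let \<open>V\<close> be the common kernel of
  these characters. Then the support of \<open>m\<close> lies in \<open>v + V\<close>, while Fourier inversion shows that \<open>m\<close>
  is invariant under translation by \<open>V\<close>, hence equal to \<open>m v\<close> on \<open>v + V\<close>. The converse holds because
  a character that is nontrivial on a subspace sums to zero over it.
\<close>

definition chi :: "bit ^ 'n \<Rightarrow> bit ^ 'n \<Rightarrow> int"
  where "chi x y = (- 1) ^ (of_bit (scalar_product x y) :: nat)"

lemma chi_cases: "chi x y = 1 \<or> chi x y = - 1"
  by (cases "scalar_product x y") (auto simp: chi_def)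

lemma abs_chi [simp]: "\<bar>chi x y\<bar> = 1"
  using chi_cases[of x y] by auto

lemma chi_nonzero [simp]: "chi x y \<noteq> 0"
  using chi_cases[of x y] by auto

lemma chi_zero_left [simp]: "chi 0 y = 1"
  by (simp add: chi_def scalar_product_def)

lemma chi_commute: "chi x y = chi y x"
  by (simp only: chi_def scalar_product_def mult.commute)

lemma chi_zero_right [simp]: "chi x 0 = 1"
  by (simp add: chi_commute[of x])

lemma chi_add_left: "chi (x + x') y = chi x y * chi x' y"
proof -
  have "scalar_product (x + x') y = scalar_product x y + scalar_product x' y"
    by (simp only: scalar_product_def vector_add_component distrib_right sum.distrib)
  then show ?thesis
    unfolding chi_def by (cases "scalar_product x y"; cases "scalar_product x' y") auto
qed

text \<open>Translation by \<open>u\<close> permutes \<open>V\<close> and multiplies every term by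
  \<open>chi u y\<close>, which is -1, so the sum is its own negative.\<close>

lemma sum_chi_subspace:
  fixes V :: "(bit ^ 'n) set"
  assumes V: "vec.subspace V" and u: "u \<in> V" "chi u y \<noteq> 1"
  shows "(\<Sum>x\<in>V. chi x y) = 0"
proof -
  have "(\<Sum>x\<in>V. chi x y) = (\<Sum>x\<in>V. chi (u + x) y)"
    by (rule sum.reindex_bij_witness[of _ "\<lambda>x. u + x" "\<lambda>x. x - u"])
      (use V u in \<open>auto intro: vec.subspace_add vec.subspace_diff\<close>)
  also have "\<dots> = - (\<Sum>x\<in>V. chi x y)"
    using chi_cases[of u y] u by (simp add: chi_add_left sum_negf)
  finally show ?thesis by simp
qed

lemma exists_chi_nontrivial:
  fixes x :: "bit ^ 'n"
  assumes "x \<noteq> 0"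
  shows "\<exists>y. chi y x \<noteq> 1"
proof -
  obtain i where i: "x $ i = 1"
    using assms by (auto simp: vec_eq_iff)
  \<comment> \<open>The witness is the unit vector at a nonzero coordinate of
    \<open>x\<close>.\<close>
  have "scalar_product (axis i 1) x = (\<Sum>j\<in>UNIV. if j = i then x $ j else 0)"
    unfolding scalar_product_def by (rule sum.cong) (auto simp: axis_def)
  then have "scalar_product (axis i 1) x = 1"
    using i by simp
  then have "chi (axis i 1) x \<noteq> 1"
    by (simp add: chi_def)
  then show ?thesis ..
qed

text \<open>Orthogonality of characters, the input to Fourier inversion.\<close>

lemma sum_chi_UNIV:
  "(\<Sum>y\<in>UNIV. chi x y) = (if x = 0 then int CARD(bit ^ 'n) else 0)"
  for x :: "bit ^ 'n"
  using sum_chi_subspace[OF vec.subspace_UNIV] exists_chi_nontrivial[of x]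
  by (auto simp: chi_commute[of x])

lemma signed_sum_eq: "signed_sum m y = (\<Sum>x\<in>UNIV. int (m x) * chi x y)"
  unfolding signed_sum_def chi_def
  by (rule sum.mono_neutral_left) (auto simp: support_def)

lemma bit_vec_add_self: "x + x = 0" for x :: "bit ^ 'n"
  by (simp add: vec_eq_iff)

lemma fourier_inversion:
  fixes m :: "bit ^ 'n \<Rightarrow> nat"
  shows "(\<Sum>y\<in>UNIV. signed_sum m y * chi x y) = int CARD(bit ^ 'n) * int (m x)"
proof -
  \<comment> \<open>Characteristic two: the product \<open>chi z y * chi x y\<close> merges into
    \<open>chi (z + x) y\<close>, whose sum over \<open>y\<close> survives only for
    \<open>z = x\<close>.\<close>
  have eq_iff: "z + x = 0 \<longleftrightarrow> z = x" for z
    by (metis add.commute add_left_cancel bit_vec_add_self)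
  have "(\<Sum>y\<in>UNIV. signed_sum m y * chi x y)
      = (\<Sum>y\<in>UNIV. \<Sum>z\<in>UNIV. int (m z) * chi (z + x) y)"
    by (simp add: signed_sum_eq sum_distrib_right chi_add_left mult.assoc)
  also have "\<dots> = (\<Sum>z\<in>UNIV. int (m z) * (\<Sum>y\<in>UNIV. chi (z + x) y))"
    by (subst sum.swap) (simp add: sum_distrib_left)
  also have "\<dots> = (\<Sum>z\<in>UNIV. if z = x then int (m z) * int CARD(bit ^ 'n) else 0)"
    by (rule sum.cong) (auto simp only: sum_chi_UNIV eq_iff split: if_splits)
  also have "\<dots> = int CARD(bit ^ 'n) * int (m x)"
    by (simp add: mult.commute)
  finally show ?thesis .
qed

lemma fully_balanced_iff:
  "fully_balanced m \<longleftrightarrow> (\<forall>y. signed_sum m y = 0 \<or> fixes_multiset y m)"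
  by (auto simp: fully_balanced_def balancing_set_def fixing_set_def balances_def)

text \<open>Equality case of the triangle inequality: a signed sum of maximal absolute value admits
  no cancellation, so all signs on the support agree.\<close>

lemma fixes_multiset_chi_eq:
  assumes "fixes_multiset y m" and "v \<in> support m" "x \<in> support m"
  shows "chi x y = chi v y"
proof -
  have sum0: "\<forall>z\<in>support m. chi z y = c"
    if c: "c = 1 \<or> c = - 1"
      and eq: "signed_sum m y = c * (\<Sum>x\<in>support m. int (m x))" for c
  proof -
    \<comment> \<open>This is the total minus \<open>c\<close> times the signed sum, and
      \<open>c * c = 1\<close>. Its terms are nonnegative, so each vanishes.\<close>
    have "(\<Sum>z\<in>support m. int (m z) * (1 - c * chi z y)) = 0"
    proof -
      have "(\<Sum>z\<in>support m. int (m z) * (1 - c * chi z y))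
          = (\<Sum>z\<in>support m. int (m z)) - c * signed_sum m y"
        unfolding signed_sum_def chi_def
        by (simp add: right_diff_distrib sum_subtractf sum_distrib_left mult_ac)
      then show ?thesis
        using c eq by auto
    qed
    moreover have "int (m z) * (1 - c * chi z y) \<ge> 0" for z
      using c chi_cases[of z y] by auto
    ultimately have "\<forall>z\<in>support m. int (m z) * (1 - c * chi z y) = 0"
      by (subst (asm) sum_nonneg_eq_0_iff) auto
    then show ?thesis
      using c by (auto simp: support_def)
  qed
  have "signed_sum m y = 1 * (\<Sum>x\<in>support m. int (m x)) \<or>
        signed_sum m y = (- 1) * (\<Sum>x\<in>support m. int (m x))"
    using assms(1) by (auto simp: fixes_multiset_def abs_if split: if_splits)
  then show ?thesis
    using sum0 assms(2,3) by metis
qed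

lemma fully_balanced_imp_affine:
  fixes m :: "bit ^ 'n \<Rightarrow> nat"
  assumes "support m \<noteq> {}" and fb: "fully_balanced m"
  shows "affine_subspace (support m) \<and> m constant_on support m"
proof -
  obtain v where v: "v \<in> support m"
    using assms(1) by blast
  define V where "V = {w. \<forall>y. signed_sum m y \<noteq> 0 \<longrightarrow> chi w y = 1}"
  \<comment> \<open>The only scalars are 0 and 1.\<close>
  have "c *s w \<in> V" if "w \<in> V" for c w
    using that by (cases c) (auto simp: V_def)
  then have subspace: "vec.subspace V"
    by (auto simp: vec.subspace_def V_def chi_add_left)
  have supp_V: "x - v \<in> V" if x: "x \<in> support m" for x
  proof -
    have "chi (x - v) y = 1" if "signed_sum m y \<noteq> 0" for y
    proof -
      have "chi (v + (x - v)) y = chi v y"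
        using fb that fixes_multiset_chi_eq[OF _ v x] by (auto simp: fully_balanced_iff)
      then show ?thesis
        unfolding chi_add_left by simp
    qed
    then show ?thesis by (simp add: V_def)
  qed
  have inv: "m (v + w) = m v" if "w \<in> V" for w
  proof -
    \<comment> \<open>The sums agree termwise: either the coefficient \<open>signed_sum m y\<close>
      is 0, or \<open>chi w y = 1\<close> by the choice of \<open>V\<close>.\<close>
    have "(\<Sum>y\<in>UNIV. signed_sum m y * chi (v + w) y) = (\<Sum>y\<in>UNIV. signed_sum m y * chi v y)"
      by (rule sum.cong) (use that in \<open>auto simp: V_def chi_add_left\<close>)
    then show ?thesis
      unfolding fourier_inversion by simp
  qed
  have "support m = (+) v ` V"
  proof (intro equalityI subsetI)
    fix x assume "x \<in> support m"
    then show "x \<in> (+) v ` V"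
      using supp_V by (intro image_eqI[of _ _ "x - v"]) auto
  next
    fix x assume "x \<in> (+) v ` V"
    then show "x \<in> support m"
      using inv v by (auto simp: support_def)
  qed
  then show ?thesis
    using subspace inv by (auto simp: affine_subspace_def constant_on_def)
qed

lemma affine_imp_fully_balanced:
  fixes m :: "bit ^ 'n \<Rightarrow> nat"
  assumes "affine_subspace (support m)" "m constant_on support m"
  shows "fully_balanced m"
  unfolding fully_balanced_iff
proof (intro allI)
  fix y
  obtain v V where V: "vec.subspace V" and supp: "support m = (+) v ` V"
    using assms(1) by (auto simp: affine_subspace_def)
  obtain c where c: "\<And>x. x \<in> support m \<Longrightarrow> m x = c"
    using assms(2) by (auto simp: constant_on_def)
  have sum_eq: "signed_sum m y = int c * chi v y * (\<Sum>u\<in>V. chi u y)"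
  proof -
    have "signed_sum m y = (\<Sum>x\<in>(+) v ` V. int c * chi x y)"
      unfolding signed_sum_def chi_def supp[symmetric] by (rule sum.cong) (auto simp: c)
    also have "\<dots> = (\<Sum>u\<in>V. int c * chi (v + u) y)"
      by (simp add: sum.reindex)
    finally show ?thesis
      by (simp add: chi_add_left sum_distrib_left mult.assoc)
  qed
  have total: "(\<Sum>x\<in>support m. int (m x)) = int c * int (card V)"
  proof -
    have "(\<Sum>x\<in>support m. int (m x)) = (\<Sum>x\<in>support m. int c)"
      by (rule sum.cong) (auto simp: c)
    then show ?thesis
      by (simp add: supp card_image mult.commute)
  qed
  show "signed_sum m y = 0 \<or> fixes_multiset y m"
  proof (cases "\<forall>u\<in>V. chi u y = 1")
    case True
    \<comment> \<open>The character sum is now \<open>card V\<close>, and the factor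
      \<open>chi v y\<close> disappears in the absolute value.\<close>
    then have "fixes_multiset y m"
      unfolding fixes_multiset_def total sum_eq by (simp add: abs_mult)
    then show ?thesis ..
  next
    case False
    then show ?thesis
      using sum_chi_subspace[OF V] sum_eq by auto
  qed
qed

theorem theorem6:
  fixes m :: "bit ^ 'n \<Rightarrow> nat"
  assumes "support m \<noteq> {}"
  shows "fully_balanced m \<longleftrightarrow> affine_subspace (support m) \<and> m constant_on support m"
  using fully_balanced_imp_affine[OF assms] affine_imp_fully_balanced by blast

end
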